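(* Let $P$ be one of the 600-cell, the 120-cell or Gosset's polytope $4_{21}$, with set of rays $R$, set of bases $\mathcal{B}$, and fifteen-fold rotation $g$ acting on $R$ and $\mathcal{B}$. The bases of $P$ fall into orbits of exactly fifteen bases under $g$, and the rays into orbits of exactly fifteen rays (the pentadecagons). Choose one generator from each basis orbit. Then a set $S\subseteq\mathcal{B}$ of bases is a fifteen-fold parity proof if and only if $S$ is the union of the $g$-orbits of an odd number of distinct generators $B_1,\dots,B_l$ such that, for every pentadecagon $Q\subset R$, the total count $\sum_{i=1}^{l}|B_i\cap Q|$ is even. Moreover, in that case each ray of a pentadecagon $Q$ occurs in exactly $\sum_{i=1}^{l}|B_i\cap Q|$ bases of $S$.
   Context: The 600-cell $\{3,3,5\}$ and 120-cell $\{5,3,3\}$ are the regular polytopes in $\mathbb{R}^4$ with 120 and 600 vertices, and Gosset's polytope $4_{21}$ is the uniform polytope in $\mathbb{R}^8$ whose 240 vertices are the roots of $E_8$; all are centered at the origin. A ray is an undirected line through the origin and a pair of antipodal vertices (so there are 60, 300 and 120 rays, respectively). A basis is a set of $N$ mutually orthogonal rays of the polytope, where $N=4$ for the 600-cell and the 120-cell and $N=8$ for Gosset's polytope (there are 75, 675 and 2025 bases, respectively). The triacontagonal projection is the orthogonal projection of the polytope to a plane (the Coxeter plane of its symmetry group $H_4$, $H_4$, or $E_8$) in which the vertices lie on concentric regular 30-gons. Let $g$ be the orthogonal symmetry of the polytope that preserves this plane and rotates it by $24^\circ$, namely the square of the Coxeter element that rotates the plane by $12^\circ$; since the 15th power of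 the Coxeter element is $-1$, $g$ has order 15 on rays and generates the same group of permutations of the rays as the Coxeter element. A pentadecagon is a $g$-orbit of rays (in the projection, after keeping one of each pair of antipodal vertices, it is a regular 15-gon). A parity proof is a set of bases of the polytope consisting of an odd number of bases such that each ray occurs in an even number (possibly zero) of the bases of the set. It is called fifteen-fold if it is invariant under $g$. A generator is a representative of a $g$-orbit of bases. *)

theory Defs
  imports "HOL-Analysis.Analysis" "HOL-Combinatorics.Orbits"
begin

section \<open>The three polytopes\<close>

datatype polytope_kind = Cell600 | Cell120 | Gosset421

fun ambient_dim :: "polytope_kind \<Rightarrow> nat" where
  "ambient_dim Cell600 = 4"
| "ambient_dim Cell120 = 4"
| "ambient_dim Gosset421 = 8"

definition golden :: real where
  "golden = (1 + sqrt 5) / 2"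

text \<open>All lists obtained from \<^term>\<open>xs\<close> by changing signs of entries.\<close>
definition signed :: "real list \<Rightarrow> real list set" where
  "signed xs = {ys. length ys = length xs \<and> (\<forall>i<length xs. \<bar>ys ! i\<bar> = \<bar>xs ! i\<bar>)}"

definition signed_perms :: "real list \<Rightarrow> real list set" where
  "signed_perms xs =
     (\<Union>p\<in>{p. p permutes {..<length xs}}. signed (permute_list p xs))"

definition signed_even_perms :: "real list \<Rightarrow> real list set" where
  "signed_even_perms xs =
     (\<Union>p\<in>{p. p permutes {..<length xs} \<and> evenperm p}. signed (permute_list p xs))"

text \<open>The standard coordinates: 120 vertices on the sphere of radius 2, 600 vertices on the
  sphere of squared radius 8 (Coxeter), and the 240 roots of $E_8$ of squared length 2.\<close>
fun coords :: "polytope_kind \<Rightarrow> real list set" where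
  "coords Cell600 =
     signed_perms [2, 0, 0, 0] \<union>
     signed [1, 1, 1, 1] \<union>
     signed_even_perms [golden, 1, 1 / golden, 0]"
| "coords Cell120 =
     signed_perms [2, 2, 0, 0] \<union>
     signed_perms [sqrt 5, 1, 1, 1] \<union>
     signed_perms [golden, golden, golden, 1 / golden^2] \<union>
     signed_perms [golden^2, 1 / golden, 1 / golden, 1 / golden] \<union>
     signed_even_perms [golden^2, 1, 1 / golden^2, 0] \<union>
     signed_even_perms [sqrt 5, golden, 1 / golden, 0] \<union>
     signed_even_perms [2, golden, 1, 1 / golden]"
| "coords Gosset421 =
     signed_perms [1, 1, 0, 0, 0, 0, 0, 0] \<union>
     {xs \<in> signed (replicate 8 (1/2)). even (card {i. i < 8 \<and> xs ! i < 0})}"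

text \<open>The polytope of kind \<^term>\<open>K\<close>, centered at the origin, is determined up to the choice of an
  orthonormal basis \<^term>\<open>b\<close> of the ambient space and of a scale \<^term>\<open>r\<close>.\<close>
definition is_polytope_of_kind :: "polytope_kind \<Rightarrow> 'a::euclidean_space set \<Rightarrow> bool" where
  "is_polytope_of_kind K P \<longleftrightarrow>
     DIM('a) = ambient_dim K \<and>
     (\<exists>(b :: nat \<Rightarrow> 'a) r. r > 0 \<and>
        (\<forall>i<ambient_dim K. \<forall>j<ambient_dim K. b i \<bullet> b j = (if i = j then 1 else 0)) \<and>
        P = convex hull ((\<lambda>xs. r *\<^sub>R (\<Sum>i<ambient_dim K. (xs ! i) *\<^sub>R b i)) ` coords K))"

definition vertices :: "'a::euclidean_space set \<Rightarrow> 'a set" where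
  "vertices P = {v. v extreme_point_of P}"

definition symmetry :: "'a::euclidean_space set \<Rightarrow> ('a \<Rightarrow> 'a) \<Rightarrow> bool" where
  "symmetry P f \<longleftrightarrow> orthogonal_transformation f \<and> f ` P = P"


section \<open>Rays and bases\<close>

definition rays :: "'a::euclidean_space set \<Rightarrow> 'a set set" where
  "rays P = {span {v} |v. v \<in> vertices P \<and> - v \<in> vertices P}"

definition orthogonal_rays :: "'a::euclidean_space set \<Rightarrow> 'a set \<Rightarrow> bool" where
  "orthogonal_rays L M \<longleftrightarrow> (\<forall>x\<in>L. \<forall>y\<in>M. orthogonal x y)"

definition bases :: "'a::euclidean_space set \<Rightarrow> 'a set set set" where
  "bases P = {B. B \<subseteq> rays P \<and> card B = DIM('a) \<and> pairwise orthogonal_rays B}"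


section \<open>Coxeter elements, the triacontagonal projection, and the fifteen-fold rotation\<close>

text \<open>The Coxeter matrices: $H_4$ is a path of four nodes whose last edge is labelled 5; $E_8$ is a
  path $0,\dots,6$ with the node 7 attached to node 4, all edges labelled 3.\<close>
definition H4_matrix :: "nat \<Rightarrow> nat \<Rightarrow> nat" where
  "H4_matrix i j =
     (if i = j then 1
      else if {i, j} = {2, 3} then 5
      else if {i, j} \<in> {{0, 1}, {1, 2}} then 3
      else 2)"

definition E8_matrix :: "nat \<Rightarrow> nat \<Rightarrow> nat" where
  "E8_matrix i j =
     (if i = j then 1
      else if {i, j} \<in> {{0, 1}, {1, 2}, {2, 3}, {3, 4}, {4, 5}, {5, 6}, {4, 7}} then 3
      else 2)"

fun coxeter_matrix :: "polytope_kind \<Rightarrow> nat \<Rightarrow> nat \<Rightarrow> nat" where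
  "coxeter_matrix Cell600 = H4_matrix"
| "coxeter_matrix Cell120 = H4_matrix"
| "coxeter_matrix Gosset421 = E8_matrix"

definition reflection :: "'a::euclidean_space \<Rightarrow> 'a \<Rightarrow> 'a" where
  "reflection a x = x - (2 * (x \<bullet> a) / (a \<bullet> a)) *\<^sub>R a"

text \<open>Unit normals of the walls of a chamber of the symmetry group, numbered along the Coxeter
  diagram: walls \<^term>\<open>i\<close> and \<^term>\<open>j\<close> meet at the dihedral angle $\pi/m_{ij}$
  (and $m_{ii} = 1$ gives norm 1).\<close>
definition simple_roots ::
    "polytope_kind \<Rightarrow> 'a::euclidean_space set \<Rightarrow> (nat \<Rightarrow> 'a) \<Rightarrow> bool" where
  "simple_roots K P a \<longleftrightarrow>
     (\<forall>i<ambient_dim K. symmetry P (reflection (a i))) \<and>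
     (\<forall>i<ambient_dim K. \<forall>j<ambient_dim K. a i \<bullet> a j = - cos (pi / real (coxeter_matrix K i j)))"

definition coxeter_element ::
    "polytope_kind \<Rightarrow> 'a::euclidean_space set \<Rightarrow> ('a \<Rightarrow> 'a) \<Rightarrow> bool" where
  "coxeter_element K P c \<longleftrightarrow>
     (\<exists>a is. simple_roots K P a \<and> distinct is \<and> set is = {..<ambient_dim K} \<and>
        c = foldr (\<lambda>i f. reflection (a i) \<circ> f) is id)"

text \<open>An oriented plane through the origin is given by an orthonormal frame \<^term>\<open>e1\<close>,
  \<^term>\<open>e2\<close> of it.\<close>
definition orthonormal_frame :: "'a::euclidean_space \<Rightarrow> 'a \<Rightarrow> bool" where
  "orthonormal_frame e1 e2 \<longleftrightarrow> norm e1 = 1 \<and> norm e2 = 1 \<and> e1 \<bullet> e2 = 0"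

definition plane_projection :: "'a::euclidean_space \<Rightarrow> 'a \<Rightarrow> 'a \<Rightarrow> 'a" where
  "plane_projection e1 e2 x = (x \<bullet> e1) *\<^sub>R e1 + (x \<bullet> e2) *\<^sub>R e2"

definition plane_point :: "'a::euclidean_space \<Rightarrow> 'a \<Rightarrow> real \<Rightarrow> real \<Rightarrow> 'a" where
  "plane_point e1 e2 r t = (r * cos t) *\<^sub>R e1 + (r * sin t) *\<^sub>R e2"

definition regular_polygon :: "nat \<Rightarrow> 'a::euclidean_space \<Rightarrow> 'a \<Rightarrow> real \<Rightarrow> real \<Rightarrow> 'a set" where
  "regular_polygon n e1 e2 r t =
     (\<lambda>k. plane_point e1 e2 r (t + 2 * pi * real k / real n)) ` {..<n}"

definition triacontagonal_plane :: "'a::euclidean_space set \<Rightarrow> 'a \<Rightarrow> 'a \<Rightarrow> bool" where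
  "triacontagonal_plane P e1 e2 \<longleftrightarrow>
     orthonormal_frame e1 e2 \<and>
     (\<exists>T. (\<forall>(r, t)\<in>T. r > 0) \<and>
        plane_projection e1 e2 ` vertices P = (\<Union>(r, t)\<in>T. regular_polygon 30 e1 e2 r t))"

definition rotates_plane :: "('a::euclidean_space \<Rightarrow> 'a) \<Rightarrow> 'a \<Rightarrow> 'a \<Rightarrow> real \<Rightarrow> bool" where
  "rotates_plane f e1 e2 t \<longleftrightarrow>
     f e1 = cos t *\<^sub>R e1 + sin t *\<^sub>R e2 \<and> f e2 = - sin t *\<^sub>R e1 + cos t *\<^sub>R e2"

text \<open>The angle $2\pi/30$ is $12^\circ$, so that \<^term>\<open>g\<close> rotates the plane by $24^\circ$.\<close>
definition fifteenfold_rotation ::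
    "polytope_kind \<Rightarrow> 'a::euclidean_space set \<Rightarrow> ('a \<Rightarrow> 'a) \<Rightarrow> bool" where
  "fifteenfold_rotation K P g \<longleftrightarrow>
     (\<exists>c e1 e2. coxeter_element K P c \<and> triacontagonal_plane P e1 e2 \<and>
        rotates_plane c e1 e2 (2 * pi / 30) \<and> g = c \<circ> c)"


section \<open>Orbits and parity proofs\<close>

text \<open>The library's \<^const>\<open>orbit\<close> collects the iterates with positive exponent; for a map of
  finite order this is the orbit under the generated cyclic group.\<close>
definition ray_orbit :: "('a \<Rightarrow> 'a) \<Rightarrow> 'a set \<Rightarrow> 'a set set" where
  "ray_orbit g L = orbit (image g) L"

definition basis_orbit :: "('a \<Rightarrow> 'a) \<Rightarrow> 'a set set \<Rightarrow> 'a set set set" where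
  "basis_orbit g B = orbit (image (image g)) B"

definition pentadecagons :: "('a \<Rightarrow> 'a) \<Rightarrow> 'a::euclidean_space set \<Rightarrow> 'a set set set" where
  "pentadecagons g P = ray_orbit g ` rays P"

definition parity_proof :: "'a::euclidean_space set \<Rightarrow> 'a set set set \<Rightarrow> bool" where
  "parity_proof P S \<longleftrightarrow>
     S \<subseteq> bases P \<and> odd (card S) \<and> (\<forall>L\<in>rays P. even (card {B\<in>S. L \<in> B}))"

definition fifteenfold_parity_proof ::
    "('a \<Rightarrow> 'a) \<Rightarrow> 'a::euclidean_space set \<Rightarrow> 'a set set set \<Rightarrow> bool" where
  "fifteenfold_parity_proof g P S \<longleftrightarrow>
     parity_proof P S \<and> image (image g) ` S = S"

definition choice_of_generators ::
    "('a \<Rightarrow> 'a) \<Rightarrow> 'a::euclidean_space set \<Rightarrow> 'a set set set \<Rightarrow> bool" where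
  "choice_of_generators g P G \<longleftrightarrow>
     G \<subseteq> bases P \<and> (\<forall>\<O>\<in>basis_orbit g ` bases P. \<exists>!B. B \<in> G \<and> B \<in> \<O>)"

end

theory Submission
  imports Defs
begin

text \<open>Every vertex has a nonzero projection to the Coxeter plane, which \<open>g\<close> rotates by \<open>24\<close> degrees, so
  \<open>g\<^sup>k\<close> can fix a ray only if \<open>15\<close> divides \<open>k\<close>.  The stabilizer of a basis acts freely on its
  \<open>4\<close> or \<open>8\<close> rays and has order dividing \<open>15\<close>, hence is trivial.  Counting incidences along free
  orbits gives the criterion.

  It remains to see that \<open>g\<^sup>1\<^sup>5 = c\<^sup>3\<^sup>0\<close> is the identity for a Coxeter element
  \<open>c = s\<^sub>1 \<cdots> s\<^sub>n\<close>, for every order of the reflections.  The roots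
  \<open>b\<^sub>i = s\<^sub>1 \<cdots> s\<^sub>i\<^sub>-\<^sub>1 a\<^sub>i\<close> satisfy
  \<open>b\<^sub>i + c b\<^sub>i = \<Sum>\<^sub>j w\<^sub>i\<^sub>j b\<^sub>j + \<Sum>\<^sub>j w\<^sub>i\<^sub>j c b\<^sub>j\<close>, where the first sum runs over the \<open>j\<close> after \<open>i\<close>, the
  second over the \<open>j\<close> before \<open>i\<close>, and \<open>w\<^sub>i\<^sub>j = - 2 a\<^sub>i \<bullet> a\<^sub>j\<close>.  Since the diagram is a tree, replacing \<open>b\<^sub>i\<close>
  by a suitable \<open>c\<^bsup>N i\<^esup> b\<^sub>i\<close> brings these relations into a form independent of the order; solving
  them from the end of an arm shows that the 30th cyclotomic polynomial of \<open>c\<close> annihilates every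
  \<open>b\<^sub>i\<close>, so \<open>c\<^sup>1\<^sup>5 b\<^sub>i = - b\<^sub>i\<close>.  Finally \<open>c x - x\<close> always lies in the span of the \<open>b\<^sub>i\<close>.\<close>

section \<open>The order of a Coxeter element\<close>

definition reflection_product :: "(nat \<Rightarrow> 'a::euclidean_space) \<Rightarrow> nat list \<Rightarrow> 'a \<Rightarrow> 'a" where
  "reflection_product a is = foldr (\<lambda>i f. reflection (a i) \<circ> f) is id"

text \<open>Phrased by the prefix before \<open>i\<close>, because \<open>orbit_root\<close>
  multiplies the reflections of exactly this prefix; if \<open>i\<close> is absent, every entry
  counts.\<close>

definition precedes :: "'b list \<Rightarrow> 'b \<Rightarrow> 'b \<Rightarrow> bool" where
  "precedes xs j i \<longleftrightarrow> j \<in> set (takeWhile (\<lambda>k. k \<noteq> i) xs)"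

text \<open>For simple roots listed once each, these are the positive roots that the inverse of the
  Coxeter element makes negative.\<close>

definition orbit_root :: "(nat \<Rightarrow> 'a::euclidean_space) \<Rightarrow> nat list \<Rightarrow> nat \<Rightarrow> 'a" where
  "orbit_root a is i = reflection_product a (takeWhile (\<lambda>k. k \<noteq> i) is) (a i)"

lemma precedes_antisym:
  assumes "distinct xs" "i \<in> set xs" "j \<in> set xs" "i \<noteq> j"
  shows "precedes xs j i \<longleftrightarrow> \<not> precedes xs i j"
  using assms by (induction xs) (auto simp: precedes_def)

section \<open>Products of reflections and the relations between their orbit roots\<close>

lemma linear_reflection: "linear (reflection a)"
  by (rule linearI)
    (auto simp: reflection_def inner_add_left algebra_simps add_divide_distrib)

lemma reflection_product_snoc:
  "reflection_product a (js @ [j]) x = reflection_product a js (reflection (a j) x)"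
proof -
  have "foldr (\<lambda>i f. reflection (a i) \<circ> f) js h x = foldr (\<lambda>i f. reflection (a i) \<circ> f) js id (h x)"
    for h
    by (induction js arbitrary: x) auto
  then show ?thesis
    by (simp add: reflection_product_def)
qed

lemma linear_reflection_product: "linear (reflection_product a js)"
proof (induction js rule: rev_induct)
  case Nil
  then show ?case by (simp add: reflection_product_def id_def linear_ident)
next
  case (snoc j js)
  have "reflection_product a (js @ [j]) = reflection_product a js \<circ> reflection (a j)"
    by (auto simp: reflection_product_snoc)
  then show ?case
    using linear_compose[OF linear_reflection snoc.IH] by metis
qed

text \<open>Induction from the right, since the last reflection acts first: it subtracts a multiple
  of \<open>a j\<close> with coefficient read from the original \<open>x\<close>, and the remaining
  product turns \<open>a j\<close> into its orbit root. Appending \<open>j\<close> leaves the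
  earlier orbit roots unchanged.\<close>

lemma reflection_product_expand:
  fixes a :: "nat \<Rightarrow> 'a::euclidean_space"
  assumes "distinct js" "\<And>j. j \<in> set js \<Longrightarrow> a j \<bullet> a j = 1"
  shows "reflection_product a js x = x - (\<Sum>j\<in>set js. (2 * (x \<bullet> a j)) *\<^sub>R orbit_root a js j)"
  using assms
proof (induction js arbitrary: x rule: rev_induct)
  case Nil
  then show ?case by (simp add: reflection_product_def)
next
  case (snoc j js)
  interpret W: linear "reflection_product a js" by (rule linear_reflection_product)
  have root_old: "orbit_root a (js @ [j]) k = orbit_root a js k" if "k \<in> set js" for k
    using that by (simp add: orbit_root_def)
  have root_new: "orbit_root a (js @ [j]) j = reflection_product a js (a j)"
  proof -
    have "takeWhile (\<lambda>k. k \<noteq> j) (js @ [j]) = js"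
      using snoc.prems(1) by (subst takeWhile_append2) auto
    then show ?thesis
      by (simp add: orbit_root_def)
  qed
  have "reflection_product a (js @ [j]) x
      = reflection_product a js x - (2 * (x \<bullet> a j)) *\<^sub>R reflection_product a js (a j)"
    using snoc.prems(2)[of j]
    by (simp add: reflection_product_snoc reflection_def W.diff W.scale)
  also have "reflection_product a js x
      = x - (\<Sum>k\<in>set js. (2 * (x \<bullet> a k)) *\<^sub>R orbit_root a js k)"
    using snoc by simp
  also have "(\<Sum>k\<in>set js. (2 * (x \<bullet> a k)) *\<^sub>R orbit_root a js k)
      = (\<Sum>k\<in>set js. (2 * (x \<bullet> a k)) *\<^sub>R orbit_root a (js @ [j]) k)"
    by (intro sum.cong) (simp_all add: root_old)
  finally show ?case
    using snoc.prems(1) by (simp add: root_new algebra_simps)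
qed

lemma takeWhile_takeWhile_precedes:
  assumes "j \<in> set (takeWhile (\<lambda>k. k \<noteq> i) xs)"
  shows "takeWhile (\<lambda>k. k \<noteq> j) (takeWhile (\<lambda>k. k \<noteq> i) xs) = takeWhile (\<lambda>k. k \<noteq> j) xs"
  using assms by (induction xs) (auto split: if_splits)

text \<open>Expand \<open>b i\<close> along its prefix and \<open>c (a i)\<close> along the whole
  word, then eliminate \<open>a i\<close>: the prefix contributes terms in \<open>c (b j)\<close>,
  the rest terms in \<open>b j\<close>. These resemble the mesh relations of Auslander-Reiten
  quivers.\<close>

lemma orbit_root_mesh:
  fixes a :: "nat \<Rightarrow> 'a::euclidean_space"
  assumes dist: "distinct is" and unit: "\<And>j. j \<in> set is \<Longrightarrow> a j \<bullet> a j = 1" and i: "i \<in> set is"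
  defines "c \<equiv> reflection_product a is" and "b \<equiv> orbit_root a is"
  shows "c (b i) + b i = (\<Sum>j\<in>set is - {i}. (- 2 * (a i \<bullet> a j)) *\<^sub>R
            (if precedes is j i then c (b j) else b j))"
proof -
  interpret c: linear c unfolding c_def by (rule linear_reflection_product)
  define xs where "xs = takeWhile (\<lambda>k. k \<noteq> i) is"
  have xs: "set xs \<subseteq> set is" "i \<notin> set xs"
    using set_takeWhileD[of _ "\<lambda>k. k \<noteq> i" "is"] by (auto simp: xs_def)
  have root_xs: "orbit_root a xs j = b j" if "j \<in> set xs" for j
    using takeWhile_takeWhile_precedes[of j i "is"] that by (simp add: orbit_root_def b_def xs_def)
  define Sx where "Sx = (\<Sum>j\<in>set xs. (2 * (a i \<bullet> a j)) *\<^sub>R b j)"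
  define Sy where "Sy = (\<Sum>j\<in>set is - {i} - set xs. (2 * (a i \<bullet> a j)) *\<^sub>R b j)"
  have "b i = reflection_product a xs (a i)"
    by (simp add: b_def orbit_root_def xs_def)
  also have "\<dots> = a i - (\<Sum>j\<in>set xs. (2 * (a i \<bullet> a j)) *\<^sub>R orbit_root a xs j)"
    using dist unit xs(1) by (intro reflection_product_expand) (auto simp: xs_def)
  also have "\<dots> = a i - (\<Sum>j\<in>set xs. (2 * (a i \<bullet> a j)) *\<^sub>R b j)"
    by (simp add: root_xs)
  finally have b: "b i = a i - (\<Sum>j\<in>set xs. (2 * (a i \<bullet> a j)) *\<^sub>R b j)" .
  have "c (a i) = a i - (\<Sum>j\<in>set is. (2 * (a i \<bullet> a j)) *\<^sub>R b j)"
    unfolding c_def b_def using dist unit by (intro reflection_product_expand) auto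
  \<comment> \<open>The term of \<open>i\<close> itself is twice \<open>b i\<close>, because
    \<open>a i\<close> is a unit vector.\<close>
  also have "set is = insert i (set xs \<union> (set is - {i} - set xs))"
    using xs i by auto
  also have "(\<Sum>j\<in>\<dots>. (2 * (a i \<bullet> a j)) *\<^sub>R b j) = 2 *\<^sub>R b i
      + ((\<Sum>j\<in>set xs. (2 * (a i \<bullet> a j)) *\<^sub>R b j)
      + (\<Sum>j\<in>set is - {i} - set xs. (2 * (a i \<bullet> a j)) *\<^sub>R b j))"
    using xs unit[OF i] by (simp add: sum.union_disjoint[OF _ _ Diff_disjoint] del: Un_Diff_cancel)
  finally have "c (a i) = a i - (2 *\<^sub>R b i + (Sx + Sy))"
    by (simp only: Sx_def Sy_def)
  moreover have "a i = b i + Sx"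
    using b by (simp add: Sx_def)
  ultimately have "c (a i) = b i + Sx - (2 *\<^sub>R b i + (Sx + Sy))"
    by metis
  then have ca: "c (a i) = - b i - Sy"
    by (simp add: scaleR_2)
  have "c (b i) = c (a i) - (\<Sum>j\<in>set xs. (2 * (a i \<bullet> a j)) *\<^sub>R c (b j))"
    by (subst b) (simp add: c.diff c.sum c.scale)
  then have "c (b i) + b i = - Sy
     - (\<Sum>j\<in>set xs. (2 * (a i \<bullet> a j)) *\<^sub>R c (b j))"
    using ca by simp
  also have "\<dots> = - (\<Sum>j\<in>set is - {i} - set xs. (2 * (a i \<bullet> a j)) *\<^sub>R b j)
     - (\<Sum>j\<in>set xs. (2 * (a i \<bullet> a j)) *\<^sub>R c (b j))"
    by (simp only: Sy_def)
  also have "\<dots> = (\<Sum>j\<in>set is - {i} - set xs. (- 2 * (a i \<bullet> a j)) *\<^sub>R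
            (if precedes is j i then c (b j) else b j))
     + (\<Sum>j\<in>set xs. (- 2 * (a i \<bullet> a j)) *\<^sub>R (if precedes is j i then c (b j) else b j))"
    by (simp add: precedes_def xs_def[symmetric] sum_negf)
  also have "\<dots> = (\<Sum>j\<in>set is - {i}. (- 2 * (a i \<bullet> a j)) *\<^sub>R
            (if precedes is j i then c (b j) else b j))"
    using xs by (intro sum.subset_diff[symmetric]) auto
  finally show ?thesis .
qed

text \<open>The shift \<open>N\<close> absorbs the order of the reflections: only the order \<open><\<close> of the indices
  remains in the relation.\<close>
lemma orbit_root_mesh_shifted:
  fixes a :: "nat \<Rightarrow> 'a::euclidean_space" and N :: "nat \<Rightarrow> nat" and w :: 'a
  assumes dist: "distinct is" and set: "set is = {..<n}"
    and unit: "\<And>j. j < n \<Longrightarrow> a j \<bullet> a j = 1" and i: "i < n"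
    and N: "\<And>i j. i < j \<Longrightarrow> j < n \<Longrightarrow> a i \<bullet> a j \<noteq> 0 \<Longrightarrow>
      N j = N i + (if precedes is j i then 1 else 0)"
  defines "c \<equiv> reflection_product a is"
  defines "x \<equiv> \<lambda>i k. (c ^^ (k + N i)) (orbit_root a is i) \<bullet> w"
  shows "x i (Suc k) + x i k
    = (\<Sum>j<n. if j = i then 0 else - 2 * (a i \<bullet> a j) * x j (if j < i then Suc k else k))"
proof -
  interpret c: linear c unfolding c_def by (rule linear_reflection_product)
  define b where "b = orbit_root a is"
  have lin: "linear (c ^^ m)" for m
    by (induction m) (simp_all add: id_def linear_ident linear_compose c.linear_axioms del: o_apply)
  have "x i (Suc k) + x i k = (c ^^ (k + N i)) (c (b i) + b i) \<bullet> w"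
    by (simp add: x_def b_def linear_add[OF lin] inner_add_left funpow_swap1)
  also have "c (b i) + b i = (\<Sum>j\<in>{..<n} - {i}. (- 2 * (a i \<bullet> a j)) *\<^sub>R
            (if precedes is j i then c (b j) else b j))"
    using orbit_root_mesh[OF dist, of a i] set unit i by (simp only: c_def b_def lessThan_iff)
  also have "(c ^^ (k + N i)) \<dots> \<bullet> w = (\<Sum>j\<in>{..<n} - {i}. - 2 * (a i \<bullet> a j) *
            ((c ^^ (k + N i)) (if precedes is j i then c (b j) else b j) \<bullet> w))"
    by (simp only: linear_sum[OF lin] linear_scale[OF lin] inner_sum_left inner_scaleR_left)
  also have "\<dots> = (\<Sum>j\<in>{..<n} - {i}. - 2 * (a i \<bullet> a j) * x j (if j < i then Suc k else k))"
  proof (rule sum.cong[OF refl])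
    fix j assume j: "j \<in> {..<n} - {i}"
    \<comment> \<open>\<open>N\<close> is constrained only along edges; for orthogonal roots the
      coefficient vanishes. If \<open>i < j\<close>, the increment from \<open>N i\<close> to
      \<open>N j\<close> occurs exactly when the extra \<open>c\<close> does; if
      \<open>j < i\<close>, the increment from \<open>N j\<close> to \<open>N i\<close> occurs
      exactly when it does not, whence \<open>Suc k\<close>.\<close>
    have "(c ^^ (k + N i)) (if precedes is j i then c (b j) else b j) \<bullet> w
        = x j (if j < i then Suc k else k)" if "a i \<bullet> a j \<noteq> 0"
    proof (cases "i < j")
      case True
      with N[of i j] j that show ?thesis
        by (simp add: x_def b_def funpow_swap1)
    next
      case False
      with j have "j < i" by simp
      with N[of j i] i that have "N i = N j + (if precedes is i j then 1 else 0)"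
        by (simp add: inner_commute)
      with \<open>j < i\<close> precedes_antisym[OF dist, of i j] set i j show ?thesis
        by (simp add: x_def b_def funpow_swap1)
    qed
    then show "- 2 * (a i \<bullet> a j) * ((c ^^ (k + N i)) (if precedes is j i then c (b j) else b j) \<bullet> w)
        = - 2 * (a i \<bullet> a j) * x j (if j < i then Suc k else k)"
      by (cases "a i \<bullet> a j = 0") simp_all
  qed
  also have "\<dots> = (\<Sum>j<n. if j = i then 0 else - 2 * (a i \<bullet> a j) * x j (if j < i then Suc k else k))"
    using i by (intro sum.mono_neutral_cong_left) auto
  finally show ?thesis .
qed

section \<open>Periodicity of the mesh recurrences of types E8 and H4\<close>

lemma E8_mesh_period:
  fixes x :: "nat \<Rightarrow> nat \<Rightarrow> real"
  assumes m0: "\<And>k. x 0 (Suc k) + x 0 k = x 1 k"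
    and m1: "\<And>k. x 1 (Suc k) + x 1 k = x 0 (Suc k) + x 2 k"
    and m2: "\<And>k. x 2 (Suc k) + x 2 k = x 1 (Suc k) + x 3 k"
    and m3: "\<And>k. x 3 (Suc k) + x 3 k = x 2 (Suc k) + x 4 k"
    and m4: "\<And>k. x 4 (Suc k) + x 4 k = x 3 (Suc k) + x 5 k + x 7 k"
    and m5: "\<And>k. x 5 (Suc k) + x 5 k = x 4 (Suc k) + x 6 k"
    and m6: "\<And>k. x 6 (Suc k) + x 6 k = x 5 (Suc k)"
    and m7: "\<And>k. x 7 (Suc k) + x 7 k = x 4 (Suc k)"
    and "i < 8"
  shows "x i (k + 15) = - x i k"
proof -
  \<comment> \<open>Node 0 ends the longest arm; every other sequence is expressed through this
    one.\<close>
  define f where "f = x 0"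
  have x1: "x 1 k = f k + f (k+1)" for k
    using m0[of k] by (simp add: f_def)
  have x2: "x 2 k = f k + f (k+1) + f (k+2)" for k
    using m1[of k] x1[of k] x1[of "Suc k"] by (simp add: f_def[symmetric])
  have x3: "x 3 k = f k + f (k+1) + f (k+2) + f (k+3)" for k
    using m2[of k] x1[of "Suc k"] x2[of k] x2[of "Suc k"] by (simp add: numeral_eq_Suc)
  have x4: "x 4 k = f k + f (k+1) + f (k+2) + f (k+3) + f (k+4)" for k
    using m3[of k] x2[of "Suc k"] x3[of k] x3[of "Suc k"] by (simp add: numeral_eq_Suc)
  \<comment> \<open>At the branch node only the sum over the two remaining neighbours is
    determined.\<close>
  have x57: "x 5 k + x 7 k = f k + f (k+1) + f (k+2) + f (k+3) + f (k+4) + f (k+5)" for k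
    using m4[of k] x3[of "Suc k"] x4[of k] x4[of "Suc k"] by (simp add: numeral_eq_Suc)
  \<comment> \<open>Adding \<open>m5\<close> and \<open>m7\<close> brings in only this sum, so
    \<open>x 6\<close> can be solved for.\<close>
  have x6: "x 6 k = f k + f (k+6)" for k
    using m5[of k] m7[of k] x4[of "Suc k"] x57[of k] x57[of "Suc k"]
    by (simp add: numeral_eq_Suc)
  have x5: "x 5 k = f (k+2) + f (k+3) + f (k+4) + f (k+5) - f (k+7)" for k
    using m5[of k] m6[of k] x4[of "Suc k"] x6[of k] x6[of "Suc k"]
    by (simp add: numeral_eq_Suc)
  have x7: "x 7 k = f k + f (k+1) + f (k+7)" for k
    using x57[of k] x5[of k] by simp
  \<comment> \<open>The 30th cyclotomic polynomial, a divisor of \<open>z\<^sup>1\<^sup>5 + 1\<close>, annihilates \<open>f\<close>.\<close>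
  have Phi: "f (k+8) + f (k+7) - f (k+5) - f (k+4) - f (k+3) + f (k+1) + f k = 0" for k
    using m6[of k] x5[of "Suc k"] x6[of k] x6[of "Suc k"] by (simp add: numeral_eq_Suc)
  \<comment> \<open>The cofactor of the cyclotomic polynomial in \<open>z^15 + 1\<close> has degree
    7, hence eight shifts.\<close>
  have f: "f (k+15) = - f k" for k
    using Phi[of k] Phi[of "k+1"] Phi[of "k+2"] Phi[of "k+3"] Phi[of "k+4"] Phi[of "k+5"]
      Phi[of "k+6"] Phi[of "k+7"]
    by (simp add: numeral_eq_Suc)
  have shift: "f (k + 15 + j) = - f (k + j)" for k j
    using f[of "k + j"] by (simp add: ac_simps)
  have "i \<in> {0, 1, 2, 3, 4, 5, 6, 7}"
    using \<open>i < 8\<close> by auto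
  then show ?thesis
    by (elim insertE emptyE; simp only: f_def[symmetric] x1 x2 x3 x4 x5 x6 x7 f shift; simp)
qed

text \<open>Over the field of \<open>sqrt 5\<close>, the 30th cyclotomic polynomial splits into two
  conjugate quartics \<open>z^4 - u * (z^3 + z^2 + z) + 1\<close>, and the recurrence of
  \<open>f\<close> is the one with \<open>u = \<phi> - 1\<close>. Multiplying it by
  \<open>u\<close>, where \<open>u^2 = 1 - u\<close>, gives a second relation; eliminating
  \<open>h\<close> then recovers the rational polynomial.\<close>

lemma H4_mesh_period:
  fixes x :: "nat \<Rightarrow> nat \<Rightarrow> real"
  assumes \<phi>: "\<phi>\<^sup>2 = \<phi> + 1"
    and m0: "\<And>k. x 0 (Suc k) + x 0 k = x 1 k"
    and m1: "\<And>k. x 1 (Suc k) + x 1 k = x 0 (Suc k) + x 2 k"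
    and m2: "\<And>k. x 2 (Suc k) + x 2 k = x 1 (Suc k) + \<phi> * x 3 k"
    and m3: "\<And>k. x 3 (Suc k) + x 3 k = \<phi> * x 2 (Suc k)"
    and "i < 4"
  shows "x i (k + 15) = - x i k"
proof -
  define f where "f = x 0"
  have x1: "x 1 k = f k + f (k+1)" for k
    using m0[of k] by (simp add: f_def)
  have x2: "x 2 k = f k + f (k+1) + f (k+2)" for k
    using m1[of k] x1[of k] x1[of "Suc k"] by (simp add: f_def[symmetric])
  have x3: "\<phi> * x 3 k = f k + f (k+1) + f (k+2) + f (k+3)" for k
    using m2[of k] x1[of "Suc k"] x2[of k] x2[of "Suc k"] by (simp add: numeral_eq_Suc)
  define h where "h k = (\<phi> - 1) * f k" for k
  have "f (k+4) + f k = (\<phi> - 1) * (f (k+1) + f (k+2) + f (k+3))" for k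
  proof -
    have "\<phi> * x 3 (Suc k) + \<phi> * x 3 k = \<phi>\<^sup>2 * x 2 (Suc k)"
      by (simp add: m3 mult.assoc power2_eq_square flip: distrib_left)
    then show ?thesis
      unfolding x2 x3 \<phi> by (simp add: numeral_eq_Suc algebra_simps)
  qed
  \<comment> \<open>The two relations below are linear over the rationals in \<open>f\<close> and \<open>h = f / \<phi>\<close>.\<close>
  then have fh: "f (k+4) + f k = h (k+1) + h (k+2) + h (k+3)" for k
    by (simp add: h_def algebra_simps)
  have hf: "h (k+4) + h k + f (k+4) + f k = f (k+1) + f (k+2) + f (k+3)" for k
  proof -
    have "(\<phi> - 1) * h j = f j - h j" for j
    proof -
      have "(\<phi> - 1) * h j = (\<phi>\<^sup>2 - 2 * \<phi> + 1) * f j"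
        by (simp add: h_def power2_eq_square algebra_simps)
      then show ?thesis
        by (simp add: \<phi> h_def algebra_simps)
    qed
    then have "(\<phi> - 1) * (h (k+1) + h (k+2) + h (k+3)) = f (k+1) + f (k+2) + f (k+3)
        - (h (k+1) + h (k+2) + h (k+3))"
      by (simp add: distrib_left)
    moreover have "(\<phi> - 1) * (f (k+4) + f k) = h (k+4) + h k"
      by (simp add: h_def distrib_left)
    ultimately show ?thesis
      using fh[of k] by simp
  qed
  \<comment> \<open>The 30th cyclotomic polynomial, a divisor of \<open>z\<^sup>1\<^sup>5 + 1\<close>, annihilates \<open>f\<close>.\<close>
  have Phi: "f (k+8) + f (k+7) - f (k+5) - f (k+4) - f (k+3) + f (k+1) + f k = 0" for k
    using fh[of k] fh[of "k+1"] fh[of "k+2"] fh[of "k+3"] fh[of "k+4"]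
      hf[of k] hf[of "k+1"] hf[of "k+2"] hf[of "k+3"] hf[of "k+4"]
    by (simp add: numeral_eq_Suc)
  have f: "f (k+15) = - f k" for k
    using Phi[of k] Phi[of "k+1"] Phi[of "k+2"] Phi[of "k+3"] Phi[of "k+4"] Phi[of "k+5"]
      Phi[of "k+6"] Phi[of "k+7"]
    by (simp add: numeral_eq_Suc)
  have shift: "f (k + 15 + j) = - f (k + j)" for k j
    using f[of "k + j"] by (simp add: ac_simps)
  have "\<phi> \<noteq> 0"
    using \<phi> by auto
  then have x3': "x 3 k = (f k + f (k+1) + f (k+2) + f (k+3)) / \<phi>" for k
    using x3[of k] by (simp add: field_simps)
  have "i \<in> {0, 1, 2, 3}"
    using \<open>i < 4\<close> by auto
  then show ?thesis
    by (elim insertE emptyE; simp only: f_def[symmetric] x1 x2 x3' f shift;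
        simp add: \<open>\<phi> \<noteq> 0\<close> field_simps)
qed

text \<open>The angles \<open>3 * pi / 5\<close> and \<open>2 * pi / 5\<close> are supplementary, so
  the triple and double angle formulas give a cubic for the cosine, whose root -1 is excluded by
  positivity.\<close>

lemma two_cos_pi_fifth: "(2 * cos (pi / 5))\<^sup>2 = 2 * cos (pi / 5) + 1"
proof -
  define x where "x = cos (pi / 5)"
  have "cos (3 * (pi / 5)) = - cos (2 * (pi / 5))"
    using cos_minus_pi[of "2 * (pi / 5)"] cos_minus[of "3 * (pi / 5)"] by (simp add: field_simps)
  then have "4 * x ^ 3 - 3 * x = - (2 * x\<^sup>2 - 1)"
    unfolding cos_treble_cos cos_double_cos x_def .
  then have "(x + 1) * (4 * x\<^sup>2 - 2 * x - 1) = 0"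
    by (simp add: algebra_simps power2_eq_square power3_eq_cube)
  moreover have "x > 0"
    unfolding x_def by (rule cos_gt_zero) auto
  ultimately show ?thesis
    by (simp add: x_def[symmetric] power_mult_distrib)
qed

text \<open>Pairing with an arbitrary \<open>w\<close> turns the mesh relations of vectors into
  recurrences of real sequences; as \<open>w\<close> varies, nothing is lost.\<close>

lemma coxeter_mesh_period:
  fixes a :: "nat \<Rightarrow> 'a::euclidean_space"
  assumes dist: "distinct is" and set: "set is = {..<ambient_dim K}"
    and gram: "\<And>i j. i < ambient_dim K \<Longrightarrow> j < ambient_dim K \<Longrightarrow>
      a i \<bullet> a j = - cos (pi / real (coxeter_matrix K i j))"
  obtains N where "\<And>i k w. i < ambient_dim K \<Longrightarrow>
    (reflection_product a is ^^ (k + 15 + N i)) (orbit_root a is i) \<bullet> w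
      = - ((reflection_product a is ^^ (k + N i)) (orbit_root a is i) \<bullet> w)"
proof -
  define e :: "nat \<Rightarrow> nat \<Rightarrow> nat" where "e i j = (if precedes is j i then 1 else 0)" for i j
  let ?x = "\<lambda>N w i k. (reflection_product a is ^^ (k + N i)) (orbit_root a is i) \<bullet> w"
  have cos60: "cos (pi / 3) = 1 / 2"
    by (simp add: cos_60)
  show ?thesis
  proof (cases "K = Gosset421")
    case True
    \<comment> \<open>\<open>N\<close> adds the increments along the path from node 0, node 7
      branching off at node 4. The diagram has no cycle, so the edge conditions cannot
      conflict.\<close>
    define N where "N = (\<lambda>i. [0, e 0 1, e 0 1 + e 1 2, e 0 1 + e 1 2 + e 2 3,
      e 0 1 + e 1 2 + e 2 3 + e 3 4, e 0 1 + e 1 2 + e 2 3 + e 3 4 + e 4 5,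
      e 0 1 + e 1 2 + e 2 3 + e 3 4 + e 4 5 + e 5 6,
      e 0 1 + e 1 2 + e 2 3 + e 3 4 + e 4 7] ! i)"
    have gram8: "a i \<bullet> a j = - cos (pi / real (E8_matrix i j))" if "i < 8" "j < 8" for i j
      using gram[of i j] that True by simp
    have set8: "set is = {..<8}"
      using set True by simp
    have unit8: "a j \<bullet> a j = 1" if "j < 8" for j
      using gram8[OF that that] by (simp add: E8_matrix_def)
    have edge: "N j = N i + (if precedes is j i then 1 else 0)" if "i < j" "j < 8" "a i \<bullet> a j \<noteq> 0" for i j
    proof -
      \<comment> \<open>The label 2 would make the two roots orthogonal.\<close>
      have "E8_matrix i j \<noteq> 2"
        using gram8[of i j] that by force
      then have "{i, j} \<in> {{0, 1}, {1, 2}, {2, 3}, {3, 4}, {4, 5}, {5, 6}, {4, 7}}"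
        using \<open>i < j\<close> by - (rule ccontr, simp add: E8_matrix_def)
      then have "(i, j) \<in> {(0, 1), (1, 2), (2, 3), (3, 4), (4, 5), (5, 6), (4, 7)}"
        using \<open>i < j\<close> by (auto simp: doubleton_eq_iff)
      then show ?thesis
        by (auto simp: N_def e_def[symmetric])
    qed
    have period: "?x N w i (k + 15) = - ?x N w i k" if "i < 8" for w i k
    proof -
      define X where "X = ?x N w"
      have mesh: "X i (Suc k) + X i k = (\<Sum>j<8. if j = i then 0
          else 2 * cos (pi / real (E8_matrix i j)) * X j (if j < i then Suc k else k))"
        if "i < 8" for i k
      proof -
        have "X i (Suc k) + X i k = (\<Sum>j<8. if j = i then 0
            else - 2 * (a i \<bullet> a j) * X j (if j < i then Suc k else k))"
          unfolding X_def by (rule orbit_root_mesh_shifted[OF dist set8 unit8 that edge])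
        also have "\<dots> = (\<Sum>j<8. if j = i then 0
            else 2 * cos (pi / real (E8_matrix i j)) * X j (if j < i then Suc k else k))"
          using that by (intro sum.cong) (simp_all add: gram8)
        finally show ?thesis .
      qed
      have "X i (k + 15) = - X i k"
        by (rule E8_mesh_period[of X, OF _ _ _ _ _ _ _ _ that]; subst mesh)
          (simp_all add: E8_matrix_def doubleton_eq_iff lessThan_nat_numeral lessThan_Suc cos60)
      then show ?thesis
        by (simp only: X_def)
    qed
    show ?thesis
      by (rule that[of N]) (use period True in simp)
  next
    case False
    define N where "N = (\<lambda>i. [0, e 0 1, e 0 1 + e 1 2, e 0 1 + e 1 2 + e 2 3] ! i)"
    have K: "ambient_dim K = 4" "coxeter_matrix K = H4_matrix"
      using False by (cases K; simp)+
    have gram4: "a i \<bullet> a j = - cos (pi / real (H4_matrix i j))" if "i < 4" "j < 4" for i j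
      using gram[of i j] that K by simp
    have set4: "set is = {..<4}"
      using set K by simp
    have unit4: "a j \<bullet> a j = 1" if "j < 4" for j
      using gram4[OF that that] by (simp add: H4_matrix_def)
    have edge: "N j = N i + (if precedes is j i then 1 else 0)" if "i < j" "j < 4" "a i \<bullet> a j \<noteq> 0" for i j
    proof -
      have "H4_matrix i j \<noteq> 2"
        using gram4[of i j] that by force
      then have "{i, j} \<in> {{0, 1}, {1, 2}, {2, 3}}"
        using \<open>i < j\<close> by - (rule ccontr, simp add: H4_matrix_def)
      then have "(i, j) \<in> {(0, 1), (1, 2), (2, 3)}"
        using \<open>i < j\<close> by (auto simp: doubleton_eq_iff)
      then show ?thesis
        by (auto simp: N_def e_def[symmetric])
    qed
    have period: "?x N w i (k + 15) = - ?x N w i k" if "i < 4" for w i k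
    proof -
      define X where "X = ?x N w"
      have mesh: "X i (Suc k) + X i k = (\<Sum>j<4. if j = i then 0
          else 2 * cos (pi / real (H4_matrix i j)) * X j (if j < i then Suc k else k))"
        if "i < 4" for i k
      proof -
        have "X i (Suc k) + X i k = (\<Sum>j<4. if j = i then 0
            else - 2 * (a i \<bullet> a j) * X j (if j < i then Suc k else k))"
          unfolding X_def by (rule orbit_root_mesh_shifted[OF dist set4 unit4 that edge])
        also have "\<dots> = (\<Sum>j<4. if j = i then 0
            else 2 * cos (pi / real (H4_matrix i j)) * X j (if j < i then Suc k else k))"
          using that by (intro sum.cong) (simp_all add: gram4)
        finally show ?thesis .
      qed
      \<comment> \<open>The edge labelled 5 has weight \<open>2 * cos (pi / 5)\<close>, the golden
        ratio; edges labelled 3 have weight 1.\<close>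
      have "X i (k + 15) = - X i k"
        by (rule H4_mesh_period[of _ X, OF two_cos_pi_fifth _ _ _ _ that]; subst mesh)
          (simp_all add: H4_matrix_def doubleton_eq_iff lessThan_nat_numeral lessThan_Suc cos60)
      then show ?thesis
        by (simp only: X_def)
    qed
    show ?thesis
      by (rule that[of N]) (use period K in simp)
  qed
qed

section \<open>The 30th power of a Coxeter element\<close>

lemma coxeter_element_symmetry:
  fixes P :: "'a::euclidean_space set"
  assumes "coxeter_element K P c"
  shows "symmetry P c"
proof -
  obtain a "is" where simple: "simple_roots K P a"
    and set: "set is = {..<ambient_dim K}" and c: "c = reflection_product a is"
    using assms by (auto simp: coxeter_element_def reflection_product_def)
  have "symmetry P (reflection_product a js)" if "set js \<subseteq> {..<ambient_dim K}" for js
    using that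
  proof (induction js)
    case Nil
    then show ?case
      by (simp add: symmetry_def reflection_product_def orthogonal_transformation_id)
  next
    case (Cons j js)
    have "reflection_product a (j # js) = reflection (a j) \<circ> reflection_product a js"
      by (simp add: reflection_product_def)
    moreover have "symmetry P (reflection (a j))"
      using simple Cons.prems by (simp add: simple_roots_def)
    ultimately show ?case
      using Cons unfolding symmetry_def
      by (metis image_comp insert_subset list.simps(15) orthogonal_transformation_compose)
  qed
  then show ?thesis
    using set c by simp
qed

text \<open>The recurrences make \<open>c^15\<close> a negation only on the span of the orbit roots,
  but this span contains all differences \<open>c z - z\<close>, hence also
  \<open>y = c^30 x - x\<close>. On \<open>c x - x\<close> the power \<open>c^30\<close> is the
  identity, so \<open>c\<close> fixes \<open>y\<close>, and \<open>y = - y\<close>.\<close>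

lemma coxeter_element_funpow_30:
  fixes P :: "'a::euclidean_space set"
  assumes "coxeter_element K P c"
  shows "(c ^^ 30) x = x"
proof -
  obtain a "is" where simple: "simple_roots K P a" and dist: "distinct is"
    and set: "set is = {..<ambient_dim K}" and c: "c = reflection_product a is"
    using assms by (auto simp: coxeter_element_def reflection_product_def)
  define b where "b = orbit_root a is"
  have gram: "a i \<bullet> a j = - cos (pi / real (coxeter_matrix K i j))"
    if "i < ambient_dim K" "j < ambient_dim K" for i j
    using simple that by (simp add: simple_roots_def)
  have unit: "a j \<bullet> a j = 1" if "j \<in> set is" for j
    using gram[of j j] that set
    by (cases K) (auto simp: H4_matrix_def E8_matrix_def)
  interpret c: linear c unfolding c by (rule linear_reflection_product)
  have lin: "linear (c ^^ m)" for m
    by (induction m) (simp_all add: id_def linear_ident linear_compose c.linear_axioms del: o_apply)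
  have "inj c"
    using coxeter_element_symmetry[OF assms] orthogonal_transformation_inj
    by (auto simp: symmetry_def)
  then have inj: "inj (c ^^ m)" for m
    by (rule inj_fn)
  obtain N where N: "\<And>i k w. i < ambient_dim K \<Longrightarrow>
    (c ^^ (k + 15 + N i)) (b i) \<bullet> w = - ((c ^^ (k + N i)) (b i) \<bullet> w)"
    using coxeter_mesh_period[OF dist set gram] unfolding c b_def by metis
  have b15: "(c ^^ 15) (b i) = - b i" if "i \<in> set is" for i
  proof -
    have "(c ^^ (0 + 15 + N i)) (b i) = - ((c ^^ (0 + N i)) (b i))"
      using N[of i 0] that set by (intro vector_eq_ldot[THEN iffD1]) (auto simp: inner_commute)
    \<comment> \<open>The shift by \<open>N i\<close> is cancelled by injectivity of the powers of
      \<open>c\<close>.\<close>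
    then have "(c ^^ N i) ((c ^^ 15) (b i)) = (c ^^ N i) (- b i)"
      by (simp add: linear_neg[OF lin] add.commute[of 15] funpow_add del: funpow.simps)
    then show ?thesis
      using inj by (simp add: inj_eq)
  qed
  have anti: "(c ^^ 15) (c z - z) = - (c z - z)" for z
  proof -
    have "c z - z = - (\<Sum>j\<in>set is. (2 * (z \<bullet> a j)) *\<^sub>R b j)"
      using reflection_product_expand[OF dist unit, where x = z] by (simp add: c b_def)
    then show ?thesis
      by (simp add: linear_neg[OF lin] linear_sum[OF lin] linear_scale[OF lin] b15 sum_negf
          del: funpow.simps)
  qed
  \<comment> \<open>\<open>c\<^sup>1\<^sup>5\<close> negates \<open>y\<close> while \<open>c\<close> fixes it.\<close>
  define y where "y = (c ^^ 30) x - x"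
  have "(c ^^ 15) ((c ^^ m) x - x) = - ((c ^^ m) x - x)" for m
  proof (induction m)
    case 0
    then show ?case by (simp add: linear_0[OF lin] del: funpow.simps)
  next
    case (Suc m)
    \<comment> \<open>Telescoping into differences of the form \<open>c z - z\<close>.\<close>
    have "(c ^^ Suc m) x - x = (c ((c ^^ m) x) - (c ^^ m) x) + ((c ^^ m) x - x)"
      by simp
    then show ?case
      using Suc anti[of "(c ^^ m) x"] by (simp only: linear_add[OF lin]) simp
  qed
  then have anti_y: "(c ^^ 15) y = - y"
    by (simp add: y_def)
  have "c y - y = (c ^^ 30) (c x - x) - (c x - x)"
    by (simp add: y_def linear_diff[OF lin] c.diff funpow_swap1 del: funpow.simps)
  also have "(c ^^ 30) (c x - x) = (c ^^ 15) ((c ^^ 15) (c x - x))"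
    using funpow_add[of 15 15 c] by (simp del: funpow.simps)
  finally have "c y = y"
    by (simp only: anti linear_neg[OF lin]) simp
  then have "(c ^^ m) y = y" for m
    by (induction m) auto
  with anti_y have "y = - y"
    by metis
  then have "2 *\<^sub>R y = 0"
    unfolding scaleR_2 eq_neg_iff_add_eq_0 .
  then have "y = 0"
    by simp
  then show ?thesis
    by (simp add: y_def)
qed

section \<open>Free cyclic orbits\<close>

lemma inj_on_funpow_free:
  assumes period: "(f ^^ n) x = x" and free: "\<And>k. (f ^^ k) x = x \<Longrightarrow> n dvd k"
  shows "inj_on (\<lambda>k. (f ^^ k) x) {..<n}"
proof -
  have "i = j" if "i \<le> j" "j < n" "(f ^^ i) x = (f ^^ j) x" for i j
  proof (rule ccontr)
    assume "i \<noteq> j"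
    \<comment> \<open>Applying \<open>f^(n - j)\<close> replaces an inverse; the exponent
      \<open>n - j + i\<close> lies strictly between 0 and \<open>n\<close>.\<close>
    have "(f ^^ (n - j + i)) x = (f ^^ (n - j + j)) x"
      using that(3) by (simp only: funpow_add o_apply)
    then have "n dvd n - j + i"
      using that(2) period by (intro free) simp
    then show False
      using that(1,2) \<open>i \<noteq> j\<close> by (auto dest!: dvd_imp_le)
  qed
  then show ?thesis
    by (auto intro!: inj_onI) (metis nat_le_linear)
qed

lemma card_orbit_free:
  assumes "n > 0" "(f ^^ n) x = x" "\<And>k. (f ^^ k) x = x \<Longrightarrow> n dvd k"
  shows "card (orbit f x) = n"
proof -
  have "orbit f x = (\<lambda>k. (f ^^ k) x) ` {..<n}"
    using orbit_altdef_bounded[OF assms(2,1)] by auto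
  then show ?thesis
    using card_image[OF inj_on_funpow_free[OF assms(2,3)]] by simp
qed

text \<open>\<open>orbit\<close> starts at exponent 1, so membership of the starting point comes
  from the period.\<close>

lemma periodic_self_in_orbit:
  assumes "n > 0" "(f ^^ n) x = x"
  shows "x \<in> orbit f x"
  using assms unfolding orbit_altdef by force

lemma orbit_eq_of_mem:
  assumes "x \<in> orbit f x" "y \<in> orbit f x"
  shows "orbit f y = orbit f x"
  using orbit_trans[OF _ assms(2)] orbit_trans[OF _ orbit_swap[OF assms]] by blast

lemma orbit_closed_subset:
  assumes "x \<in> A" "\<And>y. y \<in> A \<Longrightarrow> f y \<in> A"
  shows "orbit f x \<subseteq> A"
proof
  fix y assume "y \<in> orbit f x"
  then show "y \<in> A"
    by induction (use assms in auto)
qed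

lemma funpow_image:
  fixes f :: "'a \<Rightarrow> 'a"
  shows "((`) f ^^ k) A = (f ^^ k) ` A"
  by (induction k) (simp_all add: image_comp)

text \<open>The orbits partition \<open>B\<close> into blocks of size \<open>n\<close>.\<close>

lemma dvd_card_free:
  assumes "finite B" "\<And>x. x \<in> B \<Longrightarrow> f x \<in> B" "n > 0"
    and period: "\<And>x. x \<in> B \<Longrightarrow> (f ^^ n) x = x"
    and free: "\<And>x k. x \<in> B \<Longrightarrow> (f ^^ k) x = x \<Longrightarrow> n dvd k"
  shows "n dvd card B"
proof -
  have self: "x \<in> orbit f x" if "x \<in> B" for x
    using periodic_self_in_orbit[OF \<open>n > 0\<close> period[OF that]] .
  have "\<Union>(orbit f ` B) = B"
    using self orbit_closed_subset[of _ B f] assms(2) by blast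
  moreover have "n * card (orbit f ` B) = card (\<Union>(orbit f ` B))"
  proof (rule card_partition)
    show "finite (orbit f ` B)" "finite (\<Union>(orbit f ` B))"
      using \<open>finite B\<close> \<open>\<Union>(orbit f ` B) = B\<close> by auto
    show "card c = n" if "c \<in> orbit f ` B" for c
      using that card_orbit_free[OF \<open>n > 0\<close> period free] by auto
    show "c1 \<inter> c2 = {}" if "c1 \<in> orbit f ` B" "c2 \<in> orbit f ` B" "c1 \<noteq> c2" for c1 c2
    proof -
      have "c = orbit f z" if "c \<in> orbit f ` B" "z \<in> c" for c z
        using that self orbit_eq_of_mem[of _ f z] by auto
      then show ?thesis
        using that by blast
    qed
  qed
  ultimately show ?thesis
    by (metis dvd_triv_left)
qed

text \<open>With \<open>m = n / gcd k n\<close>, the map \<open>f^k\<close> acts on \<open>B\<close>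
  with all orbits of size \<open>m\<close>. So \<open>m\<close> divides both \<open>card B\<close>
  and \<open>n\<close>, which forces \<open>m = 1\<close>.\<close>

lemma image_fixed_period_dvd:
  assumes "finite B" "coprime n (card B)" "n > 0"
    and period: "\<And>x. x \<in> B \<Longrightarrow> (f ^^ n) x = x"
    and free: "\<And>x k. x \<in> B \<Longrightarrow> (f ^^ k) x = x \<Longrightarrow> n dvd k"
    and fixed: "(f ^^ k) ` B = B"
  shows "n dvd k"
proof -
  define d where "d = gcd k n"
  define m where "m = n div d"
  have n: "n = m * d" and k: "k = (k div d) * d"
    by (auto simp: d_def m_def)
  then have "d > 0" "m > 0"
    using \<open>n > 0\<close> by (auto intro: Nat.gr0I)
  have cop: "coprime (k div d) m"
    unfolding d_def m_def using \<open>n > 0\<close> by (intro div_gcd_coprime) auto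
  have "m dvd card B"
  proof (rule dvd_card_free[where f = "f ^^ k"])
    show "(f ^^ k) x \<in> B" if "x \<in> B" for x
      using fixed that by blast
    show "((f ^^ k) ^^ m) x = x" if "x \<in> B" for x
    proof -
      have "m * k = (k div d) * n"
        using n k by (metis mult.assoc mult.commute)
      then show ?thesis
        using funpow_mod_eq[OF period[OF that], of "m * k"] by (simp add: funpow_mult mult.commute)
    qed
    show "m dvd j" if "x \<in> B" "((f ^^ k) ^^ j) x = x" for x j
    proof -
      have "m * d dvd (k div d) * d * j"
        using free[OF that(1), of "k * j"] that(2) n k
        by (simp add: funpow_mult mult.commute)
      then have "m dvd (k div d) * j"
        using \<open>d > 0\<close> by (simp add: mult.commute mult.left_commute)
      then show ?thesis
        using cop by (simp add: coprime_commute coprime_dvd_mult_right_iff)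
    qed
  qed (use assms \<open>m > 0\<close> in auto)
  moreover have "m dvd n"
    by (simp add: n)
  ultimately have "m = 1"
    using \<open>coprime n (card B)\<close> coprime_common_divisor_nat by blast
  then have "n = d"
    using n by simp
  then show ?thesis
    by (metis d_def gcd_dvd1)
qed

text \<open>Both sides count the exponents \<open>k < n\<close> with \<open>L \<in> f\<^sup>k B\<close>, equivalently
  \<open>f\<^sup>n\<^sup>-\<^sup>k L \<in> B\<close>.\<close>
lemma card_orbit_containing:
  assumes "n > 0" and period: "\<And>x. (f ^^ n) x = x"
    and freeL: "\<And>k. (f ^^ k) L = L \<Longrightarrow> n dvd k"
    and freeB: "\<And>k. (f ^^ k) ` B = B \<Longrightarrow> n dvd k"
  shows "card {C \<in> orbit ((`) f) B. L \<in> C} = card (B \<inter> orbit f L)"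
proof -
  define I where "I = {k. k < n \<and> L \<in> (f ^^ k) ` B}"
  have periodB: "((`) f ^^ n) B = B"
    by (simp add: funpow_image period)
  have I: "L \<in> (f ^^ k) ` B \<longleftrightarrow> (f ^^ (n - k)) L \<in> B" if "k < n" for k
  proof -
    have "(f ^^ k) ((f ^^ (n - k)) x) = x" "(f ^^ (n - k)) ((f ^^ k) x) = x" for x
      using that period funpow_add[of k "n - k" f] funpow_add[of "n - k" k f]
      by (metis add.commute comp_apply le_add_diff_inverse less_or_eq_imp_le)+
    then show ?thesis
      by (metis (no_types, lifting) image_iff)
  qed
  have "card {C \<in> orbit ((`) f) B. L \<in> C} = card ((\<lambda>k. ((`) f ^^ k) B) ` I)"
    using orbit_altdef_bounded[OF periodB \<open>n > 0\<close>]
    by (intro arg_cong[where f = card]) (auto simp: I_def funpow_image)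
  also have "\<dots> = card I"
    using inj_on_funpow_free[OF periodB] freeB
    by (intro card_image inj_on_subset[where B = I and A = "{..<n}"])
      (auto simp: I_def funpow_image)
  also have "\<dots> = card ((\<lambda>k. (f ^^ (n - k)) L) ` I)"
  proof (rule card_image[symmetric])
    show "inj_on (\<lambda>k. (f ^^ (n - k)) L) I"
    proof (rule inj_onI)
      fix i j assume ij: "i \<in> I" "j \<in> I" "(f ^^ (n - i)) L = (f ^^ (n - j)) L"
      \<comment> \<open>The exponents \<open>n - i\<close> run from 1 to \<open>n\<close>; one
        further inverse step, written as \<open>f^(n - 1)\<close>, brings them below
        \<open>n\<close>, where the powers are known to be distinct.\<close>
      have "(f ^^ (n - 1 - i)) L = (f ^^ (n - 1 - j)) L"
      proof -
        have "(f ^^ (n - 1 - l)) L = (f ^^ (n - 1)) ((f ^^ (n - l)) L)" if "l \<in> I" for l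
        proof -
          have "n - 1 + (n - l) = n - 1 - l + n"
            using that by (auto simp: I_def)
          then have "(f ^^ (n - 1)) ((f ^^ (n - l)) L) = (f ^^ (n - 1 - l)) ((f ^^ n) L)"
            by (metis comp_apply funpow_add)
          then show ?thesis
            by (simp add: period)
        qed
        then show ?thesis
          using ij by simp
      qed
      then have "n - 1 - i = n - 1 - j"
        using inj_onD[OF inj_on_funpow_free[OF period freeL]] \<open>n > 0\<close> by simp
      then show "i = j"
        using ij by (auto simp: I_def)
    qed
  qed
  also have "(\<lambda>k. (f ^^ (n - k)) L) ` I = B \<inter> orbit f L"
  proof (intro equalityI subsetI)
    fix x assume "x \<in> (\<lambda>k. (f ^^ (n - k)) L) ` I"
    then show "x \<in> B \<inter> orbit f L"
      using I by (auto simp: I_def orbit_altdef)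
  next
    fix x assume x: "x \<in> B \<inter> orbit f L"
    then obtain m where m: "m < n" "x = (f ^^ m) L"
      using orbit_altdef_bounded[OF period \<open>n > 0\<close>] by auto
    \<comment> \<open>Chosen so that \<open>n - k\<close> is congruent to \<open>m\<close> modulo
      \<open>n\<close>; for \<open>m = 0\<close> the exponent is \<open>n\<close> itself.\<close>
    define k where "k = (if m = 0 then 0 else n - m)"
    have "k < n" "(f ^^ (n - k)) L = x"
      using m \<open>n > 0\<close> period by (auto simp: k_def)
    with I x show "x \<in> (\<lambda>k. (f ^^ (n - k)) L) ` I"
      by (auto simp: I_def image_iff)
  qed
  finally show ?thesis .
qed

section \<open>Rays and bases under the rotation\<close>

text \<open>A vertex is a singleton face, and injective linear maps carry faces to faces.\<close>

lemma vertices_symmetry: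
  assumes "symmetry P f" "v \<in> vertices P"
  shows "f v \<in> vertices P"
proof -
  have f: "linear f" "inj f" "f ` P = P"
    using assms(1) by (auto simp: symmetry_def orthogonal_transformation_linear
        orthogonal_transformation_inj)
  have "f ` {v} face_of f ` P"
    unfolding face_of_linear_image[OF f(1,2)]
    using assms(2) by (simp add: vertices_def face_of_singleton)
  then show ?thesis
    by (simp add: f(3) face_of_singleton vertices_def)
qed

lemma rays_symmetry:
  assumes "symmetry P f" "L \<in> rays P"
  shows "f ` L \<in> rays P"
proof -
  have lin: "linear f"
    using assms(1) by (simp add: symmetry_def orthogonal_transformation_linear)
  obtain v where v: "v \<in> vertices P" "- v \<in> vertices P" "L = span {v}"
    using assms(2) by (auto simp: rays_def)
  have "f ` L = span {f v}"
    using linear_span_image[OF lin, of "{v}"] v(3) by simp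
  moreover have "- f v \<in> vertices P"
    using vertices_symmetry[OF assms(1) v(2)] by (simp add: linear_neg[OF lin])
  ultimately show ?thesis
    using vertices_symmetry[OF assms(1) v(1)] by (auto simp: rays_def)
qed

lemma bases_symmetry:
  assumes "symmetry P f" "B \<in> bases P"
  shows "(`) f ` B \<in> bases P"
proof -
  have f: "orthogonal_transformation f"
    using assms(1) by (simp add: symmetry_def)
  have "inj ((`) f)"
    using orthogonal_transformation_inj[OF f] by (rule inj_on_image[where A = UNIV, simplified])
  then have "card ((`) f ` B) = card B"
    by (intro card_image) (auto intro: inj_on_subset)
  moreover have "pairwise orthogonal_rays ((`) f ` B)"
  proof (rule pairwise_imageI)
    fix L M assume "L \<in> B" "M \<in> B" "L \<noteq> M"
    then have "orthogonal_rays L M"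
      using assms(2) by (auto simp: bases_def pairwise_def)
    then show "orthogonal_rays (f ` L) (f ` M)"
      using f by (auto simp: orthogonal_rays_def orthogonal_def orthogonal_transformation_def)
  qed
  ultimately show ?thesis
    using assms(2) rays_symmetry[OF assms(1)] by (auto simp: bases_def)
qed

section \<open>The rotation of the Coxeter plane and the free action on rays\<close>

lemma rotates_plane_funpow:
  assumes c: "orthogonal_transformation c" and rot: "rotates_plane c e1 e2 t"
  shows "Complex ((c ^^ m) v \<bullet> e1) ((c ^^ m) v \<bullet> e2) = cis (real m * t) * Complex (v \<bullet> e1) (v \<bullet> e2)"
proof (induction m)
  case (Suc m)
  have inner: "c x \<bullet> c y = x \<bullet> y" for x y
    using c by (simp add: orthogonal_transformation_def)
  have lin: "linear c"
    using c by (rule orthogonal_transformation_linear)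
  have ce: "c e1 = cos t *\<^sub>R e1 + sin t *\<^sub>R e2" "c e2 = - sin t *\<^sub>R e1 + cos t *\<^sub>R e2"
    using rot by (auto simp: rotates_plane_def)
  have sq: "(cos t * cos t) *\<^sub>R u + (sin t * sin t) *\<^sub>R u = u" for u :: 'a
    by (simp flip: scaleR_add_left power2_eq_square)
  \<comment> \<open>Writing the frame as the image under \<open>c\<close> of the frame turned
    backwards lets orthogonality give the coordinates of \<open>c u\<close> for every
    \<open>u\<close>, also outside the plane.\<close>
  have e1: "e1 = c (cos t *\<^sub>R e1 - sin t *\<^sub>R e2)"
  proof -
    have "c (cos t *\<^sub>R e1 - sin t *\<^sub>R e2) = e1"
      using sq[of e1] by (simp add: ce linear_diff[OF lin] linear_scale[OF lin] algebra_simps)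
    then show ?thesis by simp
  qed
  have e2: "e2 = c (sin t *\<^sub>R e1 + cos t *\<^sub>R e2)"
  proof -
    have "c (sin t *\<^sub>R e1 + cos t *\<^sub>R e2) = e2"
      using sq[of e2] by (simp add: ce linear_add[OF lin] linear_scale[OF lin] algebra_simps)
    then show ?thesis by simp
  qed
  have step: "c u \<bullet> e1 = cos t * (u \<bullet> e1) - sin t * (u \<bullet> e2)"
    "c u \<bullet> e2 = sin t * (u \<bullet> e1) + cos t * (u \<bullet> e2)" for u
    using inner[of u "cos t *\<^sub>R e1 - sin t *\<^sub>R e2"] inner[of u "sin t *\<^sub>R e1 + cos t *\<^sub>R e2"]
    by (simp_all add: e1[symmetric] e2[symmetric] inner_diff_right inner_add_right)
  have "Complex ((c ^^ Suc m) v \<bullet> e1) ((c ^^ Suc m) v \<bullet> e2)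
      = cis t * Complex ((c ^^ m) v \<bullet> e1) ((c ^^ m) v \<bullet> e2)"
    by (simp add: step complex_eq_iff)
  also have "\<dots> = cis (real (Suc m) * t) * Complex (v \<bullet> e1) (v \<bullet> e2)"
    by (simp add: Suc.IH cis_mult algebra_simps)
  finally show ?case .
qed simp

text \<open>A zero projection would be a corner of one of the 30-gons, all of which have positive
  radius.\<close>

lemma triacontagonal_plane_vertex_nonzero:
  assumes plane: "triacontagonal_plane P e1 e2" and v: "v \<in> vertices P"
  shows "Complex (v \<bullet> e1) (v \<bullet> e2) \<noteq> 0"
proof
  assume "Complex (v \<bullet> e1) (v \<bullet> e2) = 0"
  then have zero: "plane_projection e1 e2 v = 0"
    by (simp add: plane_projection_def complex_eq_iff)
  obtain T where T: "\<forall>(r, t)\<in>T. r > 0"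
    "plane_projection e1 e2 ` vertices P = (\<Union>(r, t)\<in>T. regular_polygon 30 e1 e2 r t)"
    using plane by (auto simp: triacontagonal_plane_def)
  have "0 \<in> (\<Union>(r, t)\<in>T. regular_polygon 30 e1 e2 r t)"
    using v zero unfolding T(2)[symmetric] by force
  then obtain r s where "r > 0" and s: "plane_point e1 e2 r s = 0"
    using T(1) by (force simp: regular_polygon_def)
  have frame: "e1 \<bullet> e1 = 1" "e2 \<bullet> e2 = 1" "e1 \<bullet> e2 = 0"
    using plane by (auto simp: triacontagonal_plane_def orthonormal_frame_def norm_eq_1)
  have "plane_point e1 e2 r s \<bullet> e1 = r * cos s" "plane_point e1 e2 r s \<bullet> e2 = r * sin s"
    using frame by (simp_all add: plane_point_def inner_add_left inner_commute[of e2 e1])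
  with s \<open>r > 0\<close> have "cos s = 0" "sin s = 0"
    by auto
  then show False
    using sin_cos_squared_add[of s] by simp
qed

text \<open>If \<open>g\<^sup>k\<close> fixes the ray through \<open>v\<close>, its rotation of the plane maps the nonzero
  projection of \<open>v\<close> to a real multiple, so the angle is a multiple of \<open>\<pi>\<close>.\<close>
lemma fifteenfold_rotation_ray_free:
  assumes c: "orthogonal_transformation c" and rot: "rotates_plane c e1 e2 (2 * pi / 30)"
    and plane: "triacontagonal_plane P e1 e2" and L: "L \<in> rays P"
    and fixed: "(((c \<circ> c) ^^ k) ` L) = L"
  shows "15 dvd k"
proof -
  obtain v where v: "v \<in> vertices P" "L = span {v}"
    using L by (auto simp: rays_def)
  define z where "z = Complex (v \<bullet> e1) (v \<bullet> e2)"
  have "z \<noteq> 0"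
    using triacontagonal_plane_vertex_nonzero[OF plane v(1)] by (simp add: z_def)
  have "((c \<circ> c) ^^ k) v \<in> span {v}"
    using fixed v(2) span_base[of v "{v}"] by blast
  moreover have "(c \<circ> c) ^^ k = c ^^ (2 * k)"
    by (induction k) auto
  ultimately obtain \<mu> where \<mu>: "(c ^^ (2 * k)) v = \<mu> *\<^sub>R v"
    by (auto simp: span_singleton)
  have "complex_of_real \<mu> * z = cis (real (2 * k) * (2 * pi / 30)) * z"
    using rotates_plane_funpow[OF c rot, of "2 * k" v]
    by (simp add: \<mu> z_def complex_eq_iff)
  then have "cis (real (2 * k) * (2 * pi / 30)) = complex_of_real \<mu>"
    using \<open>z \<noteq> 0\<close> by simp
  then have "sin (real (2 * k) * (2 * pi / 30)) = 0"
    by (simp add: complex_eq_iff)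
  then obtain i :: int where "real (2 * k) * (2 * pi / 30) = of_int i * pi"
    unfolding sin_zero_iff_int2 by blast
  then have "real (2 * k) * 2 = 30 * of_int i"
    by (simp add: field_simps)
  \<comment> \<open>Over the integers this says \<open>2 * k = 15 * i\<close>, and 15 is
    odd.\<close>
  then have "int (2 * k) * 2 = 30 * i"
    by linarith
  then show ?thesis
    by presburger
qed

section \<open>Parity proofs as unions of orbits\<close>

text \<open>Orbits that meet coincide, and then one orbit would contain two chosen
  generators.\<close>

lemma choice_orbits_disjoint:
  assumes G: "choice_of_generators g P G" and T: "T \<subseteq> G"
    and self: "\<And>B. B \<in> bases P \<Longrightarrow> B \<in> basis_orbit g B"
    and B: "B \<in> T" "C \<in> T" "B \<noteq> C"
  shows "basis_orbit g B \<inter> basis_orbit g C = {}"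
proof (rule ccontr)
  assume "basis_orbit g B \<inter> basis_orbit g C \<noteq> {}"
  then obtain D where "D \<in> basis_orbit g B" "D \<in> basis_orbit g C"
    by blast
  moreover have bases: "B \<in> bases P" "C \<in> bases P"
    using G T B by (auto simp: choice_of_generators_def)
  ultimately have "basis_orbit g B = basis_orbit g C"
    using self orbit_eq_of_mem unfolding basis_orbit_def by metis
  then have "C \<in> basis_orbit g B"
    using self bases by simp
  moreover have "\<exists>!E. E \<in> G \<and> E \<in> basis_orbit g B"
    using G bases(1) by (simp add: choice_of_generators_def)
  ultimately show False
    using self[OF bases(1)] B T by blast
qed

text \<open>Disjoint orbits let both counts be added generator by generator. Every ray of
  \<open>Q\<close> has \<open>Q\<close> as its orbit, so each contribution depends only on
  \<open>Q\<close>.\<close>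

lemma fifteenfold_union:
  fixes P :: "'a::euclidean_space set" and g :: "'a \<Rightarrow> 'a"
  assumes basis_orb: "\<And>B. B \<in> bases P \<Longrightarrow>
      basis_orbit g B \<subseteq> bases P \<and> B \<in> basis_orbit g B \<and> card (basis_orbit g B) = 15"
    and ray_orb: "\<And>L. L \<in> rays P \<Longrightarrow> ray_orbit g L \<subseteq> rays P \<and> L \<in> ray_orbit g L"
    and count: "\<And>L B. L \<in> rays P \<Longrightarrow> B \<in> bases P \<Longrightarrow>
      card {C \<in> basis_orbit g B. L \<in> C} = card (B \<inter> ray_orbit g L)"
    and G: "choice_of_generators g P G" and T: "T \<subseteq> G" "finite T"
    and S: "S = (\<Union>B\<in>T. basis_orbit g B)"
  shows "card S = 15 * card T"
    and "\<And>Q L. Q \<in> pentadecagons g P \<Longrightarrow> L \<in> Q \<Longrightarrow>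
      card {B \<in> S. L \<in> B} = (\<Sum>B\<in>T. card (B \<inter> Q))"
proof -
  have disj: "basis_orbit g B \<inter> basis_orbit g C = {}" if "B \<in> T" "C \<in> T" "B \<noteq> C" for B C
    using choice_orbits_disjoint[OF G T(1) _ that] basis_orb by blast
  have bases: "B \<in> bases P" if "B \<in> T" for B
    using G T that by (auto simp: choice_of_generators_def)
  \<comment> \<open>An infinite set would have \<open>card\<close> 0 instead of 15.\<close>
  have fin: "finite (basis_orbit g B)" if "B \<in> T" for B
    using basis_orb[OF bases[OF that]] by (metis card.infinite zero_neq_numeral)
  have "card S = (\<Sum>B\<in>T. card (basis_orbit g B))"
    unfolding S using T(2) fin disj by (intro card_UN_disjoint) auto
  also have "\<dots> = (\<Sum>B\<in>T. 15)"
    using basis_orb bases by (intro sum.cong) auto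
  finally show "card S = 15 * card T"
    by simp
  fix Q L assume Q: "Q \<in> pentadecagons g P" and L: "L \<in> Q"
  then obtain M where M: "M \<in> rays P" "Q = ray_orbit g M"
    by (auto simp: pentadecagons_def)
  have LQ: "ray_orbit g L = Q" and "L \<in> rays P"
    using ray_orb[OF M(1)] L orbit_eq_of_mem[of M "(`) g" L] M(2) by (auto simp: ray_orbit_def)
  have "{B \<in> S. L \<in> B} = (\<Union>B\<in>T. {C \<in> basis_orbit g B. L \<in> C})"
    by (auto simp: S)
  moreover have "{D \<in> basis_orbit g B. L \<in> D} \<inter> {D \<in> basis_orbit g C. L \<in> D} = {}"
    if "B \<in> T" "C \<in> T" "B \<noteq> C" for B C
    using disj[OF that] by blast
  ultimately have "card {B \<in> S. L \<in> B} = (\<Sum>B\<in>T. card {C \<in> basis_orbit g B. L \<in> C})"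
    using T(2) fin by (simp only:, intro card_UN_disjoint) simp_all
  also have "\<dots> = (\<Sum>B\<in>T. card (B \<inter> Q))"
    using count[OF \<open>L \<in> rays P\<close>] bases LQ by (intro sum.cong) auto
  finally show "card {B \<in> S. L \<in> B} = (\<Sum>B\<in>T. card (B \<inter> Q))" .
qed

text \<open>An invariant \<open>S\<close> contains the orbit of each member, hence also the
  generator chosen from that orbit.\<close>

lemma invariant_eq_union_orbits:
  assumes basis_orb: "\<And>B. B \<in> bases P \<Longrightarrow> B \<in> basis_orbit g B"
    and G: "choice_of_generators g P G" and S: "S \<subseteq> bases P" "image (image g) ` S = S"
  shows "S = (\<Union>B\<in>S \<inter> G. basis_orbit g B)"
proof -
  have closed: "basis_orbit g B \<subseteq> S" if "B \<in> S" for B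
    unfolding basis_orbit_def using that S(2) by (intro orbit_closed_subset) auto
  have "\<exists>C\<in>S \<inter> G. B \<in> basis_orbit g C" if "B \<in> S" for B
  proof -
    have B: "B \<in> bases P"
      using that S(1) by blast
    then obtain C where C: "C \<in> G" "C \<in> basis_orbit g B"
      using G by (auto simp: choice_of_generators_def)
    then have "B \<in> basis_orbit g C"
      using basis_orb[OF B] orbit_swap by (metis basis_orbit_def)
    then show ?thesis
      using C closed[OF that] by blast
  qed
  then show ?thesis
    using closed by blast
qed

lemma union_orbits_invariant:
  assumes self: "\<And>B. B \<in> T \<Longrightarrow> B \<in> basis_orbit g B"
  shows "image (image g) ` (\<Union>B\<in>T. basis_orbit g B) = (\<Union>B\<in>T. basis_orbit g B)"
proof -
  have "image (image g) ` basis_orbit g B = basis_orbit g B" if "B \<in> T" for B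
  proof
    show "image (image g) ` basis_orbit g B \<subseteq> basis_orbit g B"
      by (auto simp: basis_orbit_def intro: orbit.step)
    show "basis_orbit g B \<subseteq> image (image g) ` basis_orbit g B"
    proof
      fix C assume "C \<in> basis_orbit g B"
      \<comment> \<open>An orbit element is the image of an earlier one or of \<open>B\<close>
        itself, and \<open>B\<close> lies in its own orbit.\<close>
      then show "C \<in> image (image g) ` basis_orbit g B"
        using self[OF that] unfolding basis_orbit_def by cases auto
    qed
  qed
  then show ?thesis
    by (simp add: image_UN)
qed

section \<open>The parity criterion for the three polytopes\<close>

theorem mainTheorem1:
  fixes P :: "'a::euclidean_space set" and K :: polytope_kind and g :: "'a \<Rightarrow> 'a"
  assumes "is_polytope_of_kind K P"
    and "fifteenfold_rotation K P g"
  shows "(\<forall>B\<in>bases P. basis_orbit g B \<subseteq> bases P \<and> B \<in> basis_orbit g B \<and> card (basis_orbit g B) = 15) \<and>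
    (\<forall>L\<in>rays P. ray_orbit g L \<subseteq> rays P \<and> L \<in> ray_orbit g L \<and> card (ray_orbit g L) = 15) \<and>
    (\<forall>G. choice_of_generators g P G \<longrightarrow>
      (\<forall>S. S \<subseteq> bases P \<longrightarrow>
        (fifteenfold_parity_proof g P S \<longleftrightarrow>
          (\<exists>T. T \<subseteq> G \<and> odd (card T) \<and> S = (\<Union>B\<in>T. basis_orbit g B) \<and>
             (\<forall>Q\<in>pentadecagons g P. even (\<Sum>B\<in>T. card (B \<inter> Q))))) \<and>
        (\<forall>T. fifteenfold_parity_proof g P S \<and> T \<subseteq> G \<and> S = (\<Union>B\<in>T. basis_orbit g B) \<longrightarrow>
          (\<forall>Q\<in>pentadecagons g P. \<forall>L\<in>Q.
             card {B\<in>S. L \<in> B} = (\<Sum>B\<in>T. card (B \<inter> Q))))))"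
proof -
  obtain c e1 e2 where c: "coxeter_element K P c" and plane: "triacontagonal_plane P e1 e2"
    and rot: "rotates_plane c e1 e2 (2 * pi / 30)" and g: "g = c \<circ> c"
    using assms(2) by (auto simp: fifteenfold_rotation_def)
  have sym_c: "symmetry P c"
    using coxeter_element_symmetry[OF c] .
  then have orth: "orthogonal_transformation c"
    by (simp add: symmetry_def)
  have sym: "symmetry P g"
    using sym_c orthogonal_transformation_compose[OF orth orth]
    by (metis g image_comp symmetry_def)
  have "g ^^ 15 = c ^^ 30"
    by (simp add: g numeral_eq_Suc comp_assoc)
  then have g15: "(g ^^ 15) x = x" for x
    using coxeter_element_funpow_30[OF c] by simp
  have ray_period: "((`) g ^^ 15) L = L" for L
    by (simp add: funpow_image g15)
  have basis_period: "((`) ((`) g) ^^ 15) B = B" for B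
    by (simp add: funpow_image[of _ "(`) g"] ray_period)
  have ray_free: "15 dvd k" if "L \<in> rays P" "((`) g ^^ k) L = L" for L k
    using fifteenfold_rotation_ray_free[OF orth rot plane that(1)] that(2)
    by (simp add: funpow_image g)
  have basis_free: "15 dvd k" if B: "B \<in> bases P" and fixed: "((`) g ^^ k) ` B = B" for B k
  proof -
    have "card B = 4 \<or> card B = 8"
      using assms(1) B by (cases K) (auto simp: is_polytope_of_kind_def bases_def)
    moreover have "coprime 15 (4 :: nat)" "coprime 15 (8 :: nat)"
      by (simp_all add: coprime_iff_gcd_eq_1 gcd_nat.simps)
    ultimately have "finite B" "coprime 15 (card B)"
      by (auto intro: card_ge_0_finite)
    then show ?thesis
    proof (rule image_fixed_period_dvd)
      show "15 dvd j" if "L \<in> B" "((`) g ^^ j) L = L" for L j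
        using B that ray_free by (auto simp: bases_def)
      show "((`) g ^^ k) ` B = B"
        by (rule fixed)
    qed (simp_all add: ray_period)
  qed
  have basis_orb: "basis_orbit g B \<subseteq> bases P \<and> B \<in> basis_orbit g B \<and> card (basis_orbit g B) = 15"
    if B: "B \<in> bases P" for B
  proof -
    have "basis_orbit g B \<subseteq> bases P"
      unfolding basis_orbit_def using B bases_symmetry[OF sym] by (rule orbit_closed_subset)
    moreover have "B \<in> basis_orbit g B"
      unfolding basis_orbit_def using basis_period by (intro periodic_self_in_orbit[of 15]) auto
    moreover have "card (basis_orbit g B) = 15"
      unfolding basis_orbit_def using basis_period basis_free[OF B]
      by (intro card_orbit_free) (auto simp: funpow_image[of _ "(`) g"])
    ultimately show ?thesis
      by blast
  qed
  have ray_orb: "ray_orbit g L \<subseteq> rays P \<and> L \<in> ray_orbit g L \<and> card (ray_orbit g L) = 15"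
    if L: "L \<in> rays P" for L
  proof -
    have "ray_orbit g L \<subseteq> rays P"
      unfolding ray_orbit_def using L rays_symmetry[OF sym] by (rule orbit_closed_subset)
    moreover have "L \<in> ray_orbit g L"
      unfolding ray_orbit_def using ray_period by (intro periodic_self_in_orbit[of 15]) auto
    moreover have "card (ray_orbit g L) = 15"
      unfolding ray_orbit_def using ray_period ray_free[OF L] by (intro card_orbit_free) auto
    ultimately show ?thesis
      by blast
  qed
  have count: "card {C \<in> basis_orbit g B. L \<in> C} = card (B \<inter> ray_orbit g L)"
    if "L \<in> rays P" "B \<in> bases P" for L B
    unfolding basis_orbit_def ray_orbit_def
    using ray_free[OF that(1)] basis_free[OF that(2)]
    by (intro card_orbit_containing[of 15]) (auto simp: ray_period)
  have union: "card S = 15 * card T"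
    "\<And>Q L. Q \<in> pentadecagons g P \<Longrightarrow> L \<in> Q \<Longrightarrow> card {B \<in> S. L \<in> B} = (\<Sum>B\<in>T. card (B \<inter> Q))"
    if "choice_of_generators g P G" "T \<subseteq> G" "finite T" "S = (\<Union>B\<in>T. basis_orbit g B)" for G S T
  proof -
    have rays: "ray_orbit g L \<subseteq> rays P \<and> L \<in> ray_orbit g L" if "L \<in> rays P" for L
      using ray_orb[OF that] by simp
    show "card S = 15 * card T"
      by (rule fifteenfold_union(1)[OF _ _ _ that]; fact basis_orb rays count)
    show "card {B \<in> S. L \<in> B} = (\<Sum>B\<in>T. card (B \<inter> Q))"
      if "Q \<in> pentadecagons g P" "L \<in> Q" for Q L
      by (rule fifteenfold_union(2)[OF _ _ _ \<open>choice_of_generators g P G\<close> \<open>T \<subseteq> G\<close> \<open>finite T\<close>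
            \<open>S = (\<Union>B\<in>T. basis_orbit g B)\<close> that]; fact basis_orb rays count)
  qed
  \<comment> \<open>\<open>S\<close> is finite because its \<open>card\<close> is odd, hence not the
    default value 0 of infinite sets; each generator lies in its orbit, so \<open>T\<close> is
    contained in \<open>S\<close>.\<close>
  have fin: "finite T"
    if "fifteenfold_parity_proof g P S" "choice_of_generators g P G" "T \<subseteq> G"
      "S = (\<Union>B\<in>T. basis_orbit g B)" for G S T
  proof -
    have "T \<subseteq> S"
    proof
      fix B assume "B \<in> T"
      moreover have "B \<in> bases P"
        using \<open>B \<in> T\<close> that(2,3) by (auto simp: choice_of_generators_def)
      ultimately show "B \<in> S"
        unfolding that(4) using basis_orb by blast
    qed
    moreover have "finite S"
      using that(1) card.infinite[of S]
      by (fastforce simp: fifteenfold_parity_proof_def parity_proof_def)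
    ultimately show ?thesis
      by (rule finite_subset)
  qed
  have forward: "\<exists>T. T \<subseteq> G \<and> odd (card T) \<and> S = (\<Union>B\<in>T. basis_orbit g B) \<and>
      (\<forall>Q\<in>pentadecagons g P. even (\<Sum>B\<in>T. card (B \<inter> Q)))"
    if G: "choice_of_generators g P G" and S: "fifteenfold_parity_proof g P S" for G S
  proof -
    have S': "S \<subseteq> bases P" "image (image g) ` S = S" "odd (card S)"
      "\<And>L. L \<in> rays P \<Longrightarrow> even (card {B \<in> S. L \<in> B})"
      using S by (auto simp: fifteenfold_parity_proof_def parity_proof_def)
    have eq: "S = (\<Union>B\<in>S \<inter> G. basis_orbit g B)"
      by (rule invariant_eq_union_orbits[OF _ G S'(1,2)]) (use basis_orb in blast)
    have "finite (S \<inter> G)"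
      by (rule fin[OF S G _ eq]) simp
    note U = union[OF G Int_lower2 this eq]
    \<comment> \<open>Fifteen is odd, so \<open>S\<close> and its set of generators have
      cardinalities of equal parity.\<close>
    have "odd (card (S \<inter> G))"
      using U(1) S'(3) by simp
    moreover have "even (\<Sum>B\<in>S \<inter> G. card (B \<inter> Q))" if Q: "Q \<in> pentadecagons g P" for Q
    proof -
      obtain L where L: "L \<in> rays P" "Q = ray_orbit g L"
        using Q by (auto simp: pentadecagons_def)
      then have "card {B \<in> S. L \<in> B} = (\<Sum>B\<in>S \<inter> G. card (B \<inter> Q))"
        using ray_orb[OF L(1)] by (intro U(2)[OF Q]) auto
      then show ?thesis
        using S'(4)[OF L(1)] by simp
    qed
    ultimately show ?thesis
      using eq by blast
  qed
  have backward: "fifteenfold_parity_proof g P S"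
    if G: "choice_of_generators g P G" and S: "S \<subseteq> bases P" and T: "T \<subseteq> G" "odd (card T)"
      "S = (\<Union>B\<in>T. basis_orbit g B)"
      and even: "\<forall>Q\<in>pentadecagons g P. even (\<Sum>B\<in>T. card (B \<inter> Q))" for G S T
  proof -
    \<comment> \<open>Again an infinite set would have the even \<open>card\<close> 0.\<close>
    have "finite T"
      using T(2) card.infinite[of T] by fastforce
    note U = union[OF G T(1) this T(3)]
    have "image (image g) ` S = S"
      unfolding T(3)
    proof (rule union_orbits_invariant)
      fix B assume "B \<in> T"
      then have "B \<in> bases P"
        using G T(1) by (auto simp: choice_of_generators_def)
      then show "B \<in> basis_orbit g B"
        using basis_orb by blast
    qed
    moreover have "even (card {B \<in> S. L \<in> B})" if "L \<in> rays P" for L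
    proof -
      have Q: "ray_orbit g L \<in> pentadecagons g P"
        using that by (simp add: pentadecagons_def)
      with U(2)[OF Q, of L] even ray_orb[OF that] show ?thesis
        by simp
    qed
    ultimately show ?thesis
      unfolding fifteenfold_parity_proof_def parity_proof_def using S U(1) T(2) by simp
  qed
  show ?thesis
  proof (intro conjI allI impI)
    fix G S assume G: "choice_of_generators g P G" and S: "S \<subseteq> bases P"
    show "fifteenfold_parity_proof g P S \<longleftrightarrow>
        (\<exists>T. T \<subseteq> G \<and> odd (card T) \<and> S = (\<Union>B\<in>T. basis_orbit g B) \<and>
           (\<forall>Q\<in>pentadecagons g P. even (\<Sum>B\<in>T. card (B \<inter> Q))))"
      using forward[OF G, of S] backward[OF G S] by (intro iffI) (assumption | blast)+
    fix T assume T: "fifteenfold_parity_proof g P S \<and> T \<subseteq> G \<and> S = (\<Union>B\<in>T. basis_orbit g B)"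
    show "\<forall>Q\<in>pentadecagons g P. \<forall>L\<in>Q. card {B \<in> S. L \<in> B} = (\<Sum>B\<in>T. card (B \<inter> Q))"
    proof (intro ballI)
      fix Q L assume "Q \<in> pentadecagons g P" "L \<in> Q"
      then show "card {B \<in> S. L \<in> B} = (\<Sum>B\<in>T. card (B \<inter> Q))"
        using T fin[of S G T] G by (intro union(2)[of G T]) auto
    qed
  qed (use basis_orb ray_orb in blast)+
qed

end
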